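(* Let $a\ge1$ and $x\ge2$ be integers, let $n=2^a$, and let $\omega_n$ be the number of distinct prime factors of $x^n-1$. Then $$x\;\ge\;\min\left[\left(1+2n\prod_{i=1}^{\omega_n}s_i\right)^{1/n},\ \left(1+\prod_{i=2}^{\omega_n+1}s_i\right)^{1/n}\right],$$ where $s_i$ denotes the $i$-th prime. *)

theory Defs
  imports "HOL-Library.Infinite_Set" "HOL-Computational_Algebra.Primes" Complex_Main
begin

text \<open>\<open>nth_prime i\<close> is the \<open>i\<close>-th prime counted from 1, so \<open>nth_prime 1 = 2\<close>. Since
  \<^const>\<open>enumerate\<close> counts from 0, the index is shifted; \<open>nth_prime 0\<close> is a junk value.\<close>

definition nth_prime :: "nat \<Rightarrow> nat" where
  "nth_prime i = enumerate {p::nat. prime p} (i - 1)"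

end

theory Submission imports Defs begin

text \<open>If \<open>x\<close> is even, then \<open>x\<^sup>n - 1\<close> has \<open>\<omega>\<close> distinct odd prime factors, whose product is at
  least that of the first \<open>\<omega>\<close> odd primes. If \<open>x\<close> is odd, then \<open>8\<close> divides \<open>x\<^sup>2 - 1\<close> and every
  further squaring contributes another factor \<open>2\<close>, so \<open>4n\<close> divides \<open>x\<^sup>n - 1\<close>. One of the factors
  \<open>2\<close> of \<open>4n\<close> is the prime factor \<open>2\<close> itself, so \<open>2n\<close> times the product of all \<open>\<omega>\<close> prime
  factors still divides \<open>x\<^sup>n - 1\<close>.\<close>

lemma enumerate_le_enumerate_finite_subset:
  fixes A T :: "'a :: wellorder set"
  assumes "infinite A" "finite T" "T \<subseteq> A" "i < card T"
  shows "enumerate A i \<le> enumerate T i"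
  using assms(4)
proof (induction i)
  case 0
  then have "enumerate T 0 \<in> A"
    using assms finite_enumerate_in_set by blast
  then show ?case
    by (simp add: enumerate_0[of A] Least_le)
next
  case (Suc i)
  have "enumerate A i \<le> enumerate T i"
    using Suc by simp
  also have "\<dots> < enumerate T (Suc i)"
    using assms(2) Suc.prems by (rule finite_enumerate_step)
  finally have "enumerate A i < enumerate T (Suc i)" .
  moreover have "enumerate T (Suc i) \<in> A"
    using assms Suc.prems finite_enumerate_in_set by blast
  ultimately show ?case
    by (simp add: enumerate_Suc''[OF assms(1)] Least_le)
qed

lemma prod_enumerate_le_prod:
  fixes A T :: "nat set"
  assumes "infinite A" "finite T" "T \<subseteq> A"
  shows "(\<Prod>i<card T. enumerate A i) \<le> \<Prod>T"
proof -
  have "(\<Prod>i<card T. enumerate A i) \<le> (\<Prod>i<card T. enumerate T i)"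
    using assms by (intro prod_mono) (auto intro: enumerate_le_enumerate_finite_subset)
  also have "\<dots> = \<Prod>T"
    using prod.reindex_bij_betw[OF finite_bij_enumerate[OF assms(2)], of "\<lambda>t. t"] .
  finally show ?thesis .
qed

lemma prod_nth_prime_le_prod:
  fixes T :: "nat set"
  assumes "finite T" "\<And>p. p \<in> T \<Longrightarrow> prime p"
  shows "(\<Prod>i=1..card T. nth_prime i) \<le> \<Prod>T"
proof -
  have "(\<Prod>i=1..card T. nth_prime i) = (\<Prod>i<card T. enumerate {p. prime p} i)"
    unfolding nth_prime_def
    by (rule prod.reindex_bij_witness[of _ Suc "\<lambda>i. i - 1"]) auto
  also have "\<dots> \<le> \<Prod>T"
    using assms by (intro prod_enumerate_le_prod primes_infinite) auto
  finally show ?thesis .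
qed

lemma prod_nth_prime_le_prod_int:
  fixes T :: "int set"
  assumes "finite T" "\<And>p. p \<in> T \<Longrightarrow> prime p"
  shows "(\<Prod>i=1..card T. int (nth_prime i)) \<le> \<Prod>T"
proof -
  have nonneg: "p \<ge> 0" if "p \<in> T" for p
    using assms(2)[OF that] by (rule prime_ge_0_int)
  then have inj: "inj_on nat T"
    by (intro inj_onI) (metis int_nat_eq)
  have "(\<Prod>i=1..card (nat ` T). nth_prime i) \<le> \<Prod>(nat ` T)"
    using assms by (intro prod_nth_prime_le_prod) auto
  then have "(\<Prod>i=1..card T. nth_prime i) \<le> \<Prod>(nat ` T)"
    by (simp only: card_image[OF inj])
  then have "(\<Prod>i=1..card T. int (nth_prime i)) \<le> int (\<Prod>(nat ` T))"
    by (metis of_nat_mono of_nat_prod)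
  also have "\<dots> = \<Prod>T"
    using nonneg inj by (simp add: prod.reindex)
  finally show ?thesis .
qed

lemma nth_prime_1: "nth_prime 1 = 2"
  unfolding nth_prime_def enumerate_0 diff_self_eq_0
  by (rule Least_equality) (auto simp: prime_ge_2_nat)

lemma prod_odd_nth_prime_le_prod:
  fixes T :: "int set"
  assumes "finite T" "\<And>p. p \<in> T \<Longrightarrow> prime p" "2 \<notin> T"
  shows "(\<Prod>i=2..card T + 1. int (nth_prime i)) \<le> \<Prod>T"
proof -
  have "2 * (\<Prod>i=2..card T + 1. int (nth_prime i)) =
      (\<Prod>i=1..card (insert 2 T). int (nth_prime i))"
    using assms nth_prime_1 prod.atLeast_Suc_atMost[of 1 "card T + 1" "\<lambda>i. int (nth_prime i)"]
    by (simp add: numeral_2_eq_2 del: prod.cl_ivl_Suc)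
  also have "\<dots> \<le> \<Prod>(insert 2 T)"
    using assms by (intro prod_nth_prime_le_prod_int) auto
  also have "\<dots> = 2 * \<Prod>T"
    using assms by simp
  finally show ?thesis
    by simp
qed

lemma prod_prime_factors_power_dvd:
  fixes m :: "'a :: factorial_semiring_multiplicative"
  assumes "m \<noteq> 0" "\<And>p. p \<in> prime_factors m \<Longrightarrow> e p \<le> multiplicity p m"
  shows "(\<Prod>p\<in>prime_factors m. p ^ e p) dvd m"
proof -
  have "(\<Prod>p\<in>prime_factors m. p ^ e p) dvd (\<Prod>p\<in>prime_factors m. p ^ multiplicity p m)"
    using assms(2) by (intro prod_dvd_prod le_imp_power_dvd)
  also have "\<dots> dvd m"
    using assms(1) by (simp add: prod_prime_factors)
  finally show ?thesis .
qed

lemma prod_prime_factors_dvd: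
  fixes m :: "'a :: factorial_semiring_multiplicative"
  assumes "m \<noteq> 0"
  shows "\<Prod>(prime_factors m) dvd m"
  using prod_prime_factors_power_dvd[OF assms, of "\<lambda>_. 1"]
  by (simp add: prime_factors_multiplicity Suc_le_eq)

lemma prime_power_mult_prod_prime_factors_dvd:
  fixes m p :: "'a :: factorial_semiring_multiplicative"
  assumes "m \<noteq> 0" "prime p" "p ^ Suc k dvd m"
  shows "p ^ k * \<Prod>(prime_factors m) dvd m"
proof -
  define e where "e q = (if q = p then Suc k else 1)" for q
  have "p dvd m"
    using assms(3) by (rule dvd_trans[rotated]) simp
  then have p: "p \<in> prime_factors m"
    using assms by (simp add: in_prime_factors_iff)
  have "p ^ k * \<Prod>(prime_factors m) = p ^ Suc k * \<Prod>(prime_factors m - {p})"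
    using p by (simp add: prod.remove mult_ac)
  also have "\<dots> = (\<Prod>q\<in>prime_factors m. q ^ e q)"
    using p by (simp add: prod.remove e_def)
  also have "\<dots> dvd m"
  proof (rule prod_prime_factors_power_dvd)
    fix q assume "q \<in> prime_factors m"
    moreover have "Suc k \<le> multiplicity p m"
      using assms by (intro multiplicity_geI) auto
    ultimately show "e q \<le> multiplicity q m"
      by (auto simp: e_def prime_factors_multiplicity)
  qed (fact assms(1))
  finally show ?thesis .
qed

lemma prod_odd_nth_prime_le_odd:
  fixes m :: int
  assumes "m > 0" "odd m"
  shows "(\<Prod>i=2..card (prime_factors m) + 1. int (nth_prime i)) \<le> m"
proof -
  have "2 \<notin> prime_factors m"
    using assms(2) by auto
  then have "(\<Prod>i=2..card (prime_factors m) + 1. int (nth_prime i)) \<le> \<Prod>(prime_factors m)"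
    by (intro prod_odd_nth_prime_le_prod) auto
  also have "\<dots> \<le> m"
    using assms(1) by (intro zdvd_imp_le prod_prime_factors_dvd) auto
  finally show ?thesis .
qed

lemma prime_power_mult_prod_nth_prime_le:
  fixes m p :: int
  assumes "m > 0" "prime p" "p ^ Suc k dvd m"
  shows "p ^ k * (\<Prod>i=1..card (prime_factors m). int (nth_prime i)) \<le> m"
proof -
  have "p ^ k * (\<Prod>i=1..card (prime_factors m). int (nth_prime i)) \<le> p ^ k * \<Prod>(prime_factors m)"
    using prime_ge_0_int[OF assms(2)]
    by (intro mult_left_mono prod_nth_prime_le_prod_int) auto
  also have "\<dots> \<le> m"
    using assms by (intro zdvd_imp_le prime_power_mult_prod_prime_factors_dvd) auto
  finally show ?thesis .
qed

lemma eight_dvd_odd_square_minus_one: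
  fixes x :: "'a :: ring_parity"
  assumes "odd x"
  shows "8 dvd x\<^sup>2 - 1"
proof -
  obtain k where k: "x = 2 * k + 1"
    using assms by (elim oddE)
  have "even (k * (k + 1))"
    by simp
  then obtain l where "k * (k + 1) = 2 * l"
    by (elim evenE)
  then have "4 * (k * (k + 1)) = 8 * l"
    by simp
  moreover have "x\<^sup>2 - 1 = 4 * (k * (k + 1))"
    unfolding k by (simp add: power2_eq_square algebra_simps)
  ultimately show ?thesis
    by simp
qed

lemma two_power_dvd_odd_power_minus_one:
  fixes x :: "'a :: ring_parity"
  assumes "a \<ge> 1" "odd x"
  shows "2 ^ (a + 2) dvd x ^ (2 ^ a) - 1"
  using assms(1)
proof (induction a rule: dec_induct)
  case base
  show ?case
    using eight_dvd_odd_square_minus_one[OF assms(2)] by simp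
next
  case (step a)
  let ?y = "x ^ (2 ^ a)"
  have "even (?y + 1)"
    using assms(2) by simp
  with step.IH have "2 ^ (a + 2) * 2 dvd (?y - 1) * (?y + 1)"
    by (rule mult_dvd_mono)
  also have "(?y - 1) * (?y + 1) = x ^ (2 ^ Suc a) - 1"
    by (simp add: algebra_simps mult_2 flip: power_add)
  finally show ?case
    by (simp add: mult_ac)
qed

lemma powr_inverse_le_iff:
  fixes x y :: real
  assumes "n > 0" "x \<ge> 0" "y \<ge> 0"
  shows "y powr (1 / real n) \<le> x \<longleftrightarrow> y \<le> x ^ n"
proof -
  have "y powr (1 / real n) \<le> x \<longleftrightarrow> root n y \<le> root n (x ^ n)"
    using assms by (simp add: real_root_power_cancel flip: root_powr_inverse)
  then show ?thesis
    using assms(1) by simp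
qed

lemma prod_odd_nth_prime_less_even_power:
  fixes x :: int
  assumes "n > 0" "x \<ge> 2" "even x"
  shows "(\<Prod>i=2..card (prime_factors (x ^ n - 1)) + 1. int (nth_prime i)) < x ^ n"
proof -
  have "x ^ n - 1 > 0"
    using one_less_power[of x n] assms by simp
  moreover have "odd (x ^ n - 1)"
    using assms by simp
  ultimately show ?thesis
    using prod_odd_nth_prime_le_odd[of "x ^ n - 1"] by linarith
qed

lemma two_power_mult_prod_nth_prime_less_odd_power:
  fixes x :: int
  assumes "a \<ge> 1" "x \<ge> 2" "odd x"
  shows "2 ^ (a + 1) * (\<Prod>i=1..card (prime_factors (x ^ 2 ^ a - 1)). int (nth_prime i)) < x ^ 2 ^ a"
proof -
  have "x ^ 2 ^ a - 1 > 0"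
    using one_less_power[of x "2 ^ a"] assms(2) by simp
  moreover have "2 ^ Suc (a + 1) dvd x ^ 2 ^ a - 1"
    using two_power_dvd_odd_power_minus_one[OF assms(1,3)] by simp
  ultimately show ?thesis
    using prime_power_mult_prod_nth_prime_le[OF _ two_is_prime, of "x ^ 2 ^ a - 1" "a + 1"]
    by linarith
qed

theorem theorem1p3:
  fixes a n \<omega> :: nat and x :: int
  assumes "a \<ge> 1" and "x \<ge> 2"
    and "n = 2 ^ a"
    and "\<omega> = card (prime_factors (x ^ n - 1))"
  shows "real_of_int x \<ge>
    min ((1 + 2 * real n * (\<Prod>i=1..\<omega>. real (nth_prime i))) powr (1 / real n))
        ((1 + (\<Prod>i=2..\<omega>+1. real (nth_prime i))) powr (1 / real n))"
proof -
  let ?even_bound = "\<Prod>i=2..\<omega>+1. int (nth_prime i)"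
  let ?odd_bound = "2 * int n * (\<Prod>i=1..\<omega>. int (nth_prime i))"
  have n: "n > 0"
    using assms(3) by simp
  have "?even_bound < x ^ n" if "even x"
    unfolding assms(4) using n assms(2) that by (rule prod_odd_nth_prime_less_even_power)
  moreover have "?odd_bound < x ^ n" if "odd x"
    using two_power_mult_prod_nth_prime_less_odd_power[OF assms(1,2) that]
    by (simp add: assms(3,4))
  ultimately have "1 + real_of_int ?even_bound \<le> real_of_int x ^ n \<or>
      1 + real_of_int ?odd_bound \<le> real_of_int x ^ n"
    by (auto simp only: int_less_real_le add.commute of_int_power)
  then show ?thesis
    using n assms(2)
    by (auto simp: min_le_iff_disj powr_inverse_le_iff prod_nonneg simp del: prod.cl_ivl_Suc)
qed

end
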